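(* Let $(\boldsymbol{x}^i_k,\boldsymbol{w}^i_k,\boldsymbol{z}^i_k,\boldsymbol{\mu}^i_k,\boldsymbol{\nu}^i_k,\boldsymbol{\xi}^i_k)$, $i\in\mathcal{V}$, be the iterates of the distributed ADMM algorithm described in the context. Then for all agents $i\in\mathcal{V}$ and at each iteration $k\ge 0$, the $\boldsymbol{z}^i$-update problem $$\underset{\boldsymbol{z}^i\in\mathcal{Z}}{\arg\min}\ \|\boldsymbol{z}^i-\boldsymbol{w}^i_{k+1}+\boldsymbol{\mu}^i_k\|^2$$ is equivalent (i.e. has the same set of minimizers) to the discrete linear optimization problem $$\underset{\boldsymbol{z}\in\mathcal{Z}}{\arg\min}\ \boldsymbol{z}^{\top}\boldsymbol{h}^i_k,$$ where the weight vector $\boldsymbol{h}^i_k\in\mathbb{R}^m$ is given by $\boldsymbol{h}^i_k=\boldsymbol{\mu}^i_k-\boldsymbol{w}^i_{k+1}$.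
   Context: Let $G=(\mathcal{V},\mathcal{A})$ be a directed graph with a designated root node $r\in\mathcal{V}$, $|\mathcal{V}|=n$ vertices (called agents) and $|\mathcal{A}|=m$ arcs; $N^-(i)$ and $N^+(i)$ denote the sets of in-neighbors and out-neighbors of $i\in\mathcal{V}$. Vectors in $\mathbb{R}^m$ appearing below as $\boldsymbol{z},\boldsymbol{w},\boldsymbol{\mu},\boldsymbol{h}$ (with agent superscripts) are indexed by the arcs, and $\|\cdot\|$ is the Euclidean norm. The set $\mathcal{Z}\subset\{0,1\}^m$ consists of all binary vectors $\boldsymbol{z}$ such that the set of arcs $(a,b)$ with $z_{ab}=1$ is a spanning arborescence of $G$ rooted at $r$ (a directed spanning tree containing a unique directed path from $r$ to every other node). Let $\mathcal{X}\subseteq\mathbb{R}^m$. Each agent $i$ has a local objective $f^i:\mathcal{X}\times[0,1]^m\to\mathbb{R}$ and a local constraint function $g^i:\mathcal{X}\times[0,1]^m\to\mathbb{R}^q$, the global objective being $f=\sum_{i\in\mathcal{V}}f^i$ and the global constraint $\sum_{i\in\mathcal{V}}g^i\le\boldsymbol{0}_q$, with jointly convex functions. Put $\Sigma^i=\{(\boldsymbol{x},\boldsymbol{w})\in\mathcal{X}\times[0,1]^m : g^i(\boldsymbol{x},\boldsymbol{w})\le\boldsymbol{0}_q\}$. Fix $\rho>0$. The distributed ADMM algorithm starts from some initial values with $\boldsymbol{\nu}^i_0=\boldsymbol{\xi}^i_0=\boldsymbol{0}_m$, and for every $k\ge 0$ each agent $i\in\mathcal{V}$ performs $$(\boldsymbol{x}^i,\boldsymbol{w}^i)_{k+1}=\underset{(\boldsymbol{x}^i,\boldsymbol{w}^i)\in\Sigma^i}{\arg\min}\Big\{f^i(\boldsymbol{x}^i,\boldsymbol{w}^i)+\frac{\rho}{2}\|\boldsymbol{z}^i_k-\boldsymbol{w}^i+\boldsymbol{\mu}^i_k\|^2+(\boldsymbol{\nu}^i_k)^{\top}\boldsymbol{x}^i+(\boldsymbol{\xi}^i_k)^{\top}\boldsymbol{w}^i+\frac{\rho}{2}\sum_{j\in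 N^-(i)\cup N^+(i)}\Big\|\boldsymbol{x}^i-\frac{\boldsymbol{x}^i_k+\boldsymbol{x}^j_k}{2}\Big\|^2+\frac{\rho}{2}\sum_{j\in N^-(i)\cup N^+(i)}\Big\|\boldsymbol{w}^i-\frac{\boldsymbol{w}^i_k+\boldsymbol{w}^j_k}{2}\Big\|^2\Big\},$$ $$\boldsymbol{z}^i_{k+1}=\underset{\boldsymbol{z}^i\in\mathcal{Z}}{\arg\min}\ \|\boldsymbol{z}^i-\boldsymbol{w}^i_{k+1}+\boldsymbol{\mu}^i_k\|^2,$$ $$\boldsymbol{\mu}^i_{k+1}=\boldsymbol{\mu}^i_k+\boldsymbol{z}^i_{k+1}-\boldsymbol{w}^i_{k+1},$$ $$\boldsymbol{\nu}^i_{k+1}=\boldsymbol{\nu}^i_k+\frac12\sum_{j\in N^-(i)\cup N^+(i)}(\boldsymbol{x}^i_{k+1}-\boldsymbol{x}^j_{k+1}),$$ $$\boldsymbol{\xi}^i_{k+1}=\boldsymbol{\xi}^i_k+\frac12\sum_{j\in N^-(i)\cup N^+(i)}(\boldsymbol{w}^i_{k+1}-\boldsymbol{w}^j_{k+1}).$$ Here "$=\arg\min$" in an update means that a minimizer is chosen. *)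

theory Defs
  imports "HOL-Analysis.Analysis" "Graph_Theory.Digraph_Component"
begin

text \<open>
  The library's \<^const>\<open>tree\<close> excludes directed cycles only. Together with the unique
  directed paths this leaves exactly one arc entering each \<open>v \<noteq> r\<close> and none entering
  \<open>r\<close>, so the underlying undirected graph is a tree, too.
\<close>
definition spanning_arborescence ::
  "('v, 'e) pre_digraph \<Rightarrow> ('v, 'e) pre_digraph \<Rightarrow> 'v \<Rightarrow> bool" where
  "spanning_arborescence H G r \<longleftrightarrow>
     spanning_tree H G \<and> r \<in> verts H \<and>
     (\<forall>v \<in> verts H. v \<noteq> r \<longrightarrow> (\<exists>!p. pre_digraph.apath H r p v))"

text \<open>
  Vectors indexed by the arcs are elements of \<^typ>\<open>real^'e\<close>, where \<^typ>\<open>'e\<close> is the type of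
  arcs; graphs are meant to satisfy \<open>arcs G = UNIV\<close>, so that \<open>m = CARD('e)\<close>.
\<close>
definition arborescence_vectors ::
  "('v, 'e::finite) pre_digraph \<Rightarrow> 'v \<Rightarrow> (real^'e) set" where
  "arborescence_vectors G r =
     {z. (\<forall>e. z $ e \<in> {0, 1}) \<and>
         spanning_arborescence (G\<lparr>arcs := {e \<in> arcs G. z $ e = 1}\<rparr>) G r}"

definition in_neighbors :: "('v, 'e) pre_digraph \<Rightarrow> 'v \<Rightarrow> 'v set" where
  "in_neighbors G i = {j. j \<rightarrow>\<^bsub>G\<^esub> i}"

definition out_neighbors :: "('v, 'e) pre_digraph \<Rightarrow> 'v \<Rightarrow> 'v set" where
  "out_neighbors G i = {j. i \<rightarrow>\<^bsub>G\<^esub> j}"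

abbreviation neighbors :: "('v, 'e) pre_digraph \<Rightarrow> 'v \<Rightarrow> 'v set" where
  "neighbors G i \<equiv> in_neighbors G i \<union> out_neighbors G i"

text \<open>The order on \<^typ>\<open>real^'n\<close> is componentwise, so \<open>{0..1}\<close> is the unit cube.\<close>
definition local_feasible ::
  "(real^'e) set \<Rightarrow> ((real^'e) \<times> (real^'e) \<Rightarrow> real^'q) \<Rightarrow> ((real^'e) \<times> (real^'e)) set" where
  "local_feasible X gi = {p \<in> X \<times> {0..1}. gi p \<le> 0}"

text \<open>
  Iterates are functions of the agent and the iteration number. Updates are constrained
  for the agents \<open>i \<in> verts G\<close> only.
\<close>
definition admm_iterates ::
  "('v, 'e::finite) pre_digraph \<Rightarrow> 'v \<Rightarrow> (real^'e) set \<Rightarrow>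
   ('v \<Rightarrow> (real^'e) \<times> (real^'e) \<Rightarrow> real) \<Rightarrow>
   ('v \<Rightarrow> (real^'e) \<times> (real^'e) \<Rightarrow> real^'q) \<Rightarrow> real \<Rightarrow>
   ('v \<Rightarrow> nat \<Rightarrow> real^'e) \<Rightarrow> ('v \<Rightarrow> nat \<Rightarrow> real^'e) \<Rightarrow> ('v \<Rightarrow> nat \<Rightarrow> real^'e) \<Rightarrow>
   ('v \<Rightarrow> nat \<Rightarrow> real^'e) \<Rightarrow> ('v \<Rightarrow> nat \<Rightarrow> real^'e) \<Rightarrow> ('v \<Rightarrow> nat \<Rightarrow> real^'e) \<Rightarrow> bool" where
  "admm_iterates G r X f g \<rho> x w z \<mu> \<nu> \<xi> \<longleftrightarrow>
    (\<forall>i \<in> verts G. \<nu> i 0 = 0 \<and> \<xi> i 0 = 0) \<and>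
    (\<forall>k. \<forall>i \<in> verts G.
      is_arg_min
        (\<lambda>(x', w').
            f i (x', w')
          + \<rho> / 2 * (norm (z i k - w' + \<mu> i k))\<^sup>2
          + \<nu> i k \<bullet> x' + \<xi> i k \<bullet> w'
          + \<rho> / 2 * (\<Sum>j \<in> neighbors G i. (norm (x' - (1 / 2) *\<^sub>R (x i k + x j k)))\<^sup>2)
          + \<rho> / 2 * (\<Sum>j \<in> neighbors G i. (norm (w' - (1 / 2) *\<^sub>R (w i k + w j k)))\<^sup>2))
        (\<lambda>p. p \<in> local_feasible X (g i))
        (x i (Suc k), w i (Suc k)) \<and>
      is_arg_min
        (\<lambda>z'. (norm (z' - w i (Suc k) + \<mu> i k))\<^sup>2)
        (\<lambda>z'. z' \<in> arborescence_vectors G r)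
        (z i (Suc k)) \<and>
      \<mu> i (Suc k) = \<mu> i k + z i (Suc k) - w i (Suc k) \<and>
      \<nu> i (Suc k) = \<nu> i k + (1 / 2) *\<^sub>R (\<Sum>j \<in> neighbors G i. x i (Suc k) - x j (Suc k)) \<and>
      \<xi> i (Suc k) = \<xi> i k + (1 / 2) *\<^sub>R (\<Sum>j \<in> neighbors G i. w i (Suc k) - w j (Suc k)))"

end

(* Expanding the square, the objective differs from 2 (z . h) by norm h ^ 2 + norm z ^ 2.
   For a binary vector, norm z ^ 2 is the number of selected arcs, and this is n - 1 on all of the
   feasible set: in a spanning arborescence, taking heads is a bijection from the arcs to the
   non-root vertices. *)
theory Submission
  imports Defs
begin

text \<open>A walk that repeats a vertex contains a nonempty closed walk, and from that a cycle can
  be extracted.\<close>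

lemma (in wf_digraph) forest_awalk_imp_apath:
  assumes "forest G" and "awalk u p v"
  shows "apath u p v"
proof (rule ccontr)
  assume "\<not> apath u p v"
  then obtain c w where "awalk w c w" "0 < length c"
    using awalk_not_distinct_decomp[OF \<open>awalk u p v\<close>] \<open>awalk u p v\<close> unfolding apath_def by blast
  then show False
    using closed_w_imp_cycle \<open>forest G\<close> unfolding closed_w_def forest_def by blast
qed

text \<open>Every arc is the last arc of some path from \<open>r\<close>. Two arcs with a common
  head would therefore give two different paths to it, hence injectivity. Surjectivity comes from
  the last arc of a walk from \<open>r\<close> to the given vertex.\<close>

lemma (in wf_digraph) bij_betw_head_arborescence:
  assumes forest: "forest G" and r: "r \<in> verts G"
    and path: "\<And>v. v \<in> verts G \<Longrightarrow> v \<noteq> r \<Longrightarrow> \<exists>!p. apath r p v"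
  shows "bij_betw (head G) (arcs G) (verts G - {r})"
proof -
  have reach: "\<exists>p. awalk r p v" if "v \<in> verts G" for v
  proof (cases "v = r")
    case True
    then show ?thesis using r awalk_Nil_iff by blast
  next
    case False
    then show ?thesis using path[OF that] awalkI_apath by blast
  qed
  \<comment> \<open>A walk from \<open>r\<close> to the tail of \<open>e\<close> is extended by
    \<open>e\<close>; acyclicity makes the result a path.\<close>
  have last_arc: "\<exists>q. apath r (q @ [e]) (head G e)" if e: "e \<in> arcs G" for e
  proof -
    obtain q where "awalk r q (tail G e)" using reach tail_in_verts[OF e] by blast
    then have "awalk r (q @ [e]) (head G e)"
      using arc_implies_awalk[OF e] by (rule awalk_appendI)
    then show ?thesis using forest_awalk_imp_apath[OF forest] by blast
  qed
  \<comment> \<open>A path with at least one arc has distinct ends, so no arc can enter the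
    root.\<close>
  have head_neq: "head G e \<noteq> r" if "e \<in> arcs G" for e
    using last_arc[OF that] apath_nonempty_ends by blast
  have "inj_on (head G) (arcs G)"
  proof (rule inj_onI)
    fix e e' assume e: "e \<in> arcs G" "e' \<in> arcs G" and eq: "head G e = head G e'"
    obtain q q' where "apath r (q @ [e]) (head G e)" "apath r (q' @ [e']) (head G e)"
      using last_arc e eq by metis
    then have "q @ [e] = q' @ [e']"
      using path[OF head_in_verts[OF e(1)] head_neq[OF e(1)]] by (metis (no_types))
    then show "e = e'" by simp
  qed
  moreover have "v \<in> head G ` arcs G" if "v \<in> verts G" "v \<noteq> r" for v
  proof -
    obtain p where p: "awalk r p v" using reach[OF \<open>v \<in> verts G\<close>] by blast
    then have "p \<noteq> []" using \<open>v \<noteq> r\<close> by (auto simp: awalk_Nil_iff)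
    then obtain q e where "p = q @ [e]" by (metis append_butlast_last_id)
    then have "e \<in> arcs G" "head G e = v" using p by (auto simp: awalk_simps)
    then show ?thesis by blast
  qed
  ultimately show ?thesis
    using head_neq by (auto simp: bij_betw_def)
qed

lemma card_arcs_spanning_arborescence:
  assumes "spanning_arborescence H G r"
  shows "card (arcs H) = card (verts G - {r})"
proof -
  from assms have "spanning H G" and "forest H" and "r \<in> verts H"
    and path: "\<And>v. v \<in> verts H \<Longrightarrow> v \<noteq> r \<Longrightarrow> \<exists>!p. pre_digraph.apath H r p v"
    by (auto simp: spanning_arborescence_def spanning_tree_def tree_def)
  \<comment> \<open>Being a subgraph includes being well-formed; being spanning later turns
    \<open>verts H\<close> into \<open>verts G\<close>.\<close>
  then interpret wf_digraph H
    by (simp add: spanning_def subgraph_def)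
  show ?thesis
    using bij_betw_head_arborescence[OF \<open>forest H\<close> \<open>r \<in> verts H\<close> path] \<open>spanning H G\<close>
    by (simp add: bij_betw_same_card spanning_def)
qed

lemma norm_binary_vector:
  fixes z :: "real^'e::finite"
  assumes "\<And>e. z $ e \<in> {0, 1}"
  shows "(norm z)\<^sup>2 = card {e. z $ e = 1}"
proof -
  have "(norm z)\<^sup>2 = (\<Sum>e\<in>UNIV. z $ e * z $ e)"
    by (simp add: power2_norm_eq_inner inner_vec_def)
  \<comment> \<open>Both 0 and 1 equal their own squares.\<close>
  also have "\<dots> = (\<Sum>e\<in>UNIV. if z $ e = 1 then 1 else 0)"
    using assms by (intro sum.cong) auto
  finally show ?thesis by (simp add: sum.If_cases)
qed

text \<open>The right-hand side does not depend on \<open>z\<close>: all feasible points lie on one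
  sphere around the origin. By \<open>arcs G = UNIV\<close>, the arcs of the selected subgraph are
  exactly the positions of the ones in \<open>z\<close>.\<close>

lemma norm_arborescence_vector:
  assumes "z \<in> arborescence_vectors G r" and "arcs G = UNIV"
  shows "(norm z)\<^sup>2 = card (verts G - {r})"
proof -
  have "spanning_arborescence (G\<lparr>arcs := {e. z $ e = 1}\<rparr>) G r" and "z $ e \<in> {0, 1}" for e
    using assms by (simp_all add: arborescence_vectors_def)
  then show ?thesis
    using card_arcs_spanning_arborescence norm_binary_vector[of z] by fastforce
qed

text \<open>On \<open>P\<close> the first objective is the image of the second under the strictly
  increasing map taking \<open>t\<close> to \<open>c + 2 * t + (norm h)\<^sup>2\<close>, so all
  comparisons between feasible points agree.\<close>

lemma is_arg_min_dist_iff_inner: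
  fixes h :: "'a::real_inner"
  assumes "\<And>y. P y \<Longrightarrow> (norm y)\<^sup>2 = c"
  shows "is_arg_min (\<lambda>y. (norm (y + h))\<^sup>2) P z \<longleftrightarrow> is_arg_min (\<lambda>y. y \<bullet> h) P z"
proof -
  have "(norm (y + h))\<^sup>2 = c + 2 * (y \<bullet> h) + (norm h)\<^sup>2" if "P y" for y
    using assms[OF that] by (simp add: power2_norm_eq_inner algebra_simps inner_commute)
  then show ?thesis
    by (auto simp: is_arg_min_def)
qed

theorem proposition2p2:
  fixes G :: "('v, 'e::finite) pre_digraph"
    and r :: 'v
    and X :: "(real^'e) set"
    and f :: "'v \<Rightarrow> (real^'e) \<times> (real^'e) \<Rightarrow> real"
    and g :: "'v \<Rightarrow> (real^'e) \<times> (real^'e) \<Rightarrow> real^'q"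
    and \<rho> :: real
    and x w z \<mu> \<nu> \<xi> :: "'v \<Rightarrow> nat \<Rightarrow> real^'e"
  assumes "fin_digraph G" and "nomulti_digraph G" and "arcs G = UNIV"
    and "r \<in> verts G"
    and "\<And>i. i \<in> verts G \<Longrightarrow> convex_on (X \<times> {0..1}) (f i)"
    and "\<And>i c. i \<in> verts G \<Longrightarrow> convex_on (X \<times> {0..1}) (\<lambda>p. g i p $ c)"
    and "\<rho> > 0"
    and "admm_iterates G r X f g \<rho> x w z \<mu> \<nu> \<xi>"
  shows "\<forall>i \<in> verts G. \<forall>k.
    (let h = \<mu> i k - w i (Suc k) in
      {z'. is_arg_min (\<lambda>z'. (norm (z' - w i (Suc k) + \<mu> i k))\<^sup>2)
             (\<lambda>z'. z' \<in> arborescence_vectors G r) z'}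
      = {z'. is_arg_min (\<lambda>z'. z' \<bullet> h) (\<lambda>z'. z' \<in> arborescence_vectors G r) z'})"
proof -
  \<comment> \<open>Here \<open>a\<close> and \<open>b\<close> stand for \<open>w i (Suc k)\<close>
    and \<open>\<mu> i k\<close>, so that \<open>b - a\<close> is the weight vector
    \<open>h\<close>.\<close>
  have "is_arg_min (\<lambda>y. (norm (y - a + b))\<^sup>2) (\<lambda>y. y \<in> arborescence_vectors G r) z'
      \<longleftrightarrow> is_arg_min (\<lambda>y. y \<bullet> (b - a)) (\<lambda>y. y \<in> arborescence_vectors G r) z'" for a b z'
  proof -
    have shift: "y - a + b = y + (b - a)" for y
      by simp
    show ?thesis
      unfolding shift
      \<comment> \<open>The constant \<open>c\<close> becomes
        \<open>card (verts G - {r})\<close>.\<close>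
      by (rule is_arg_min_dist_iff_inner)
        (rule norm_arborescence_vector[OF _ \<open>arcs G = UNIV\<close>])
  qed
  then show ?thesis
    by (simp add: Let_def)
qed

end
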